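(* Let $\mathbb{K}$ be a field, let $V$ be a vector space over $\mathbb{K}$ with finite positive dimension, and let $A,A^*$ be a sharp tridiagonal pair on $V$. Then there exists a unique anti-automorphism $\dagger$ of $\mathrm{End}(V)$ that fixes each of $A,A^*$. Moreover $X^{\dagger\dagger}=X$ for all $X\in\mathrm{End}(V)$.
   Context: Let $\mathbb{K}$ be a field and $V$ a vector space over $\mathbb{K}$ with finite positive dimension. $\mathrm{End}(V)$ is the $\mathbb{K}$-algebra of all $\mathbb{K}$-linear maps $V\to V$. An eigenspace of $A\in\mathrm{End}(V)$ is a nonzero subspace of the form $\{v\in V\mid Av=\theta v\}$ with $\theta\in\mathbb{K}$; $A$ is diagonalizable if $V$ is spanned by the eigenspaces of $A$. A tridiagonal pair on $V$ is an ordered pair $A,A^*\in\mathrm{End}(V)$ (here $A^*$ is just a second linear map, not an adjoint) such that: (i) each of $A,A^*$ is diagonalizable; (ii) there is an ordering $\{V_i\}_{i=0}^d$ of the eigenspaces of $A$ with $A^*V_i\subseteq V_{i-1}+V_i+V_{i+1}$ for $0\le i\le d$, where $V_{-1}=0=V_{d+1}$; (iii) there is an ordering $\{V^*_i\}_{i=0}^\delta$ of the eigenspaces of $A^*$ with $AV^*_i\subseteq V^*_{i-1}+V^*_i+V^*_{i+1}$ for $0\le i\le\delta$, where $V^*_{-1}=0=V^*_{\delta+1}$; (iv) there is no subspace $W$ of $V$ with $AW\subseteq W$, $A^*W\subseteq W$, $W\ne0$, $W\ne V$. It is known that $d=\delta$ and that, for $0\le i\le d$, the spaces $V_i,V_{d-i},V^*_i,V^*_{d-i}$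 have the same dimension, denoted $\rho_i$. The pair $A,A^*$ is called sharp if $\rho_0=1$. An anti-automorphism of $\mathrm{End}(V)$ is an isomorphism of $\mathbb{K}$-vector spaces $\sigma:\mathrm{End}(V)\to\mathrm{End}(V)$ such that $(XY)^\sigma=Y^\sigma X^\sigma$ for all $X,Y\in\mathrm{End}(V)$. *)

theory Defs
  imports "HOL.Vector_Spaces" "HOL-Library.FuncSet"
begin

text \<open>The vector space is the whole type \<open>'b\<close>, with scalar multiplication \<open>scale\<close>.\<close>

context vector_space
begin

definition Endo :: "('b \<Rightarrow> 'b) set" where
  "Endo = {X. Vector_Spaces.linear scale scale X}"

definition eigenspaces :: "('b \<Rightarrow> 'b) \<Rightarrow> 'b set set" where
  "eigenspaces A = {E. E \<noteq> {0} \<and> (\<exists>\<theta>. E = {v. A v = \<theta> *s v})}"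

definition diagonalizable :: "('b \<Rightarrow> 'b) \<Rightarrow> bool" where
  "diagonalizable A \<longleftrightarrow> span (\<Union>(eigenspaces A)) = UNIV"

text \<open>The subspace sum $V_{i-1} + V_i + V_{i+1}$ for a family indexed by \<open>0, \<dots>, d\<close>, with the
  convention $V_{-1} = 0 = V_{d+1}$.\<close>

definition adjacent_sum :: "nat \<Rightarrow> (nat \<Rightarrow> 'b set) \<Rightarrow> nat \<Rightarrow> 'b set" where
  "adjacent_sum d V i =
    {x + y + z | x y z. x \<in> (if i = 0 then {0} else V (i - 1)) \<and> y \<in> V i \<and>
                        z \<in> (if i = d then {0} else V (i + 1))}"

text \<open>\<open>V 0, \<dots>, V d\<close> lists each eigenspace of \<open>A\<close> exactly once, and \<open>B\<close> acts on the list in a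
  tridiagonal fashion.  Values of \<open>V\<close> beyond \<open>d\<close> are irrelevant.\<close>

definition standard_ordering ::
    "('b \<Rightarrow> 'b) \<Rightarrow> ('b \<Rightarrow> 'b) \<Rightarrow> nat \<Rightarrow> (nat \<Rightarrow> 'b set) \<Rightarrow> bool" where
  "standard_ordering A B d V \<longleftrightarrow>
    bij_betw V {0..d} (eigenspaces A) \<and> (\<forall>i\<in>{0..d}. B ` V i \<subseteq> adjacent_sum d V i)"

definition tridiagonal_pair :: "('b \<Rightarrow> 'b) \<Rightarrow> ('b \<Rightarrow> 'b) \<Rightarrow> bool" where
  "tridiagonal_pair A A' \<longleftrightarrow>
    A \<in> Endo \<and> A' \<in> Endo \<and>
    diagonalizable A \<and> diagonalizable A' \<and>
    (\<exists>d V. standard_ordering A A' d V) \<and>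
    (\<exists>\<delta> V'. standard_ordering A' A \<delta> V') \<and>
    \<not> (\<exists>W. subspace W \<and> A ` W \<subseteq> W \<and> A' ` W \<subseteq> W \<and> W \<noteq> {0} \<and> W \<noteq> UNIV)"

text \<open>The number $\rho_0$ is the dimension of \<open>V 0\<close>; it does not depend on the chosen ordering,
  and the existential quantifier is the weakest way of saying that it equals \<open>1\<close>.\<close>

definition sharp_tridiagonal_pair :: "('b \<Rightarrow> 'b) \<Rightarrow> ('b \<Rightarrow> 'b) \<Rightarrow> bool" where
  "sharp_tridiagonal_pair A A' \<longleftrightarrow>
    tridiagonal_pair A A' \<and> (\<exists>d V. standard_ordering A A' d V \<and> dim (V 0) = 1)"

text \<open>Maps on \<open>Endo\<close> are total functions on \<open>'b \<Rightarrow> 'b\<close>; membership in \<open>extensional Endo\<close> fixes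
  their values outside \<open>Endo\<close>, so that equality of such functions is equality of maps on \<open>Endo\<close>.\<close>

definition anti_automorphism :: "(('b \<Rightarrow> 'b) \<Rightarrow> ('b \<Rightarrow> 'b)) \<Rightarrow> bool" where
  "anti_automorphism \<sigma> \<longleftrightarrow>
    \<sigma> \<in> extensional Endo \<and>
    bij_betw \<sigma> Endo Endo \<and>
    (\<forall>X\<in>Endo. \<forall>Y\<in>Endo. \<sigma> (\<lambda>v. X v + Y v) = (\<lambda>v. \<sigma> X v + \<sigma> Y v)) \<and>
    (\<forall>c. \<forall>X\<in>Endo. \<sigma> (\<lambda>v. c *s X v) = (\<lambda>v. c *s \<sigma> X v)) \<and>
    (\<forall>X\<in>Endo. \<forall>Y\<in>Endo. \<sigma> (X \<circ> Y) = \<sigma> Y \<circ> \<sigma> X)"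

end

end

theory Submission
  imports Defs "HOL-Computational_Algebra.Polynomial"
begin

text \<open>Sharpness makes the primitive idempotent \<open>E\<close> of \<open>A\<close> for \<open>V 0\<close> a rank one map
  \<open>v \<mapsto> f v *s v\<^sub>0\<close>. The whole problem is to show that \<open>f (w v\<^sub>0)\<close> does not change
  when a word \<open>w\<close> in \<open>A\<close>, \<open>A'\<close> is reversed. Granting this,
  \<open>\<beta> (w v\<^sub>0) u = f (w\<^sup>r u)\<close>, with \<open>w\<^sup>r\<close> the reversed word, is a well-defined symmetric form,
  nondegenerate by irreducibility, for which \<open>A\<close> and \<open>A'\<close> are self-adjoint, and \<open>\<dagger>\<close> is
  its adjoint. Uniqueness holds because \<open>E\<close> has rank one, so that \<open>A\<close> and \<open>A'\<close> generate
  \<open>End(V)\<close>.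

  For the reversal symmetry, write words as alternating products
  \<open>p\<^sub>1(A') p\<^sub>2(A) p\<^sub>3(A') \<dots> p\<^sub>n(A')\<close>. If \<open>deg q \<le> b\<close>, then tridiagonality makes
  \<open>q(A')\<close> a block band matrix of width \<open>b\<close> with respect to the eigenspaces of \<open>A\<close>, and
  interpolation at the eigenvalues shows that every \<open>p(A) q(A') r(A)\<close> is a combination of such
  products with \<open>deg p < b\<close> or \<open>deg r \<le> b\<close>. The same holds with \<open>A\<close> and \<open>A'\<close>
  interchanged. So a factor of degree at most \<open>b\<close> can be moved to the right end, unless a factor
  of smaller degree appears; at the right end the last two factors contribute a scalar to
  \<open>f (w v\<^sub>0)\<close>, up to words with a factor of smaller degree.\<close>

subsection \<open>Interpolation on a band\<close>

definition lagrange :: "(nat \<Rightarrow> 'a::field) \<Rightarrow> nat set \<Rightarrow> nat \<Rightarrow> 'a poly" where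
  "lagrange \<theta> T k = (\<Prod>t\<in>T - {k}. smult (inverse (\<theta> k - \<theta> t)) [:- \<theta> t, 1:])"

lemma poly_lagrange:
  assumes "finite T" "inj_on \<theta> T" "i \<in> T" "k \<in> T"
  shows "poly (lagrange \<theta> T k) (\<theta> i) = (if i = k then 1 else 0)"
proof (cases "i = k")
  case True
  have "poly (smult (inverse (\<theta> k - \<theta> t)) [:- \<theta> t, 1:]) (\<theta> k) = 1" if "t \<in> T - {k}" for t
  proof -
    have "inverse (\<theta> k - \<theta> t) * (\<theta> k - \<theta> t) = 1"
      using that assms inj_onD[of \<theta> T k t] by (intro left_inverse) auto
    then show ?thesis by (simp add: algebra_simps)
  qed
  then have "(\<Prod>t\<in>T - {k}. poly (smult (inverse (\<theta> k - \<theta> t)) [:- \<theta> t, 1:]) (\<theta> k)) = 1"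
    by (intro prod.neutral) blast
  with True show ?thesis by (simp add: lagrange_def poly_prod)
next
  case False
  with assms show ?thesis
    by (auto simp: lagrange_def poly_prod intro!: prod_zero bexI[of _ i])
qed

lemma degree_lagrange:
  assumes "finite T" "k \<in> T"
  shows "degree (lagrange \<theta> T k) < card T"
proof -
  have "degree (lagrange \<theta> T k) \<le> (\<Sum>t\<in>T - {k}. degree (smult (inverse (\<theta> k - \<theta> t)) [:- \<theta> t, 1:]))"
    unfolding lagrange_def using degree_prod_sum_le[of "T - {k}"] assms by (simp add: o_def del: smult_pCons degree_smult_eq)
  also have "\<dots> \<le> (\<Sum>t\<in>T - {k}. 1)" by (intro sum_mono) simp
  also have "\<dots> < card T" using assms by (auto simp: card_Diff_singleton intro!: diff_less card_gt_0_iff[THEN iffD2])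
  finally show ?thesis .
qed

lemma sum_lagrange:
  fixes x :: "nat \<Rightarrow> 'a::field"
  assumes "finite T" "inj_on \<theta> T" "k \<in> T"
  shows "(\<Sum>i\<in>T. poly (lagrange \<theta> T k) (\<theta> i) * x i) = x k"
proof -
  have "(\<Sum>i\<in>T. poly (lagrange \<theta> T k) (\<theta> i) * x i) = (\<Sum>i\<in>T. if i = k then x i else 0)"
    using assms by (intro sum.cong) (auto simp: poly_lagrange)
  then show ?thesis using assms by simp
qed

text \<open>Unlike \<open>degree p < n\<close>, this admits \<open>p = 0\<close> at every
  \<open>n\<close>, including \<open>n = 0\<close>. A word with such a factor is zero, which starts
  the induction on the degree bound.\<close>

definition low_degree :: "nat \<Rightarrow> 'a::zero poly \<Rightarrow> bool" where
  "low_degree n p \<longleftrightarrow> (\<forall>i\<ge>n. coeff p i = 0)"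

lemma low_degree_0 [simp]: "low_degree 0 p \<longleftrightarrow> p = 0"
  by (auto simp: low_degree_def poly_eq_iff)

lemma low_degreeI: "degree p < n \<Longrightarrow> low_degree n p"
  by (auto simp: low_degree_def intro: coeff_eq_0)

lemma low_degree_Suc_iff: "low_degree (Suc n) p \<longleftrightarrow> degree p \<le> n"
  by (metis coeff_eq_0 degree_le le_simps(2) less_le_trans linorder_not_less low_degreeI low_degree_def not_less_eq_eq)

text \<open>Row \<open>n\<close> is eliminated with a Lagrange polynomial of degree at most \<open>b\<close> on the nodes
  \<open>n, \<dots>, n + b\<close>, and then column \<open>n\<close> with one of degree less than \<open>b\<close> on
  \<open>n + 1, \<dots>, n + b\<close>.\<close>

lemma band_matrix_eq_0:
  fixes M :: "nat \<Rightarrow> nat \<Rightarrow> 'a::field"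
  assumes inj: "inj_on \<theta> {..d}"
    and band: "\<And>i j. i \<le> d \<Longrightarrow> j \<le> d \<Longrightarrow> i + b < j \<or> j + b < i \<Longrightarrow> M i j = 0"
    and orth: "\<And>p q. low_degree b p \<or> low_degree (Suc b) q \<Longrightarrow>
      (\<Sum>i\<le>d. \<Sum>j\<le>d. poly p (\<theta> i) * poly q (\<theta> j) * M i j) = 0"
    and "i \<le> d" "j \<le> d"
  shows "M i j = 0"
proof -
  have "\<forall>k\<in>{n..d}. M n k = 0 \<and> M k n = 0" for n
  proof (induction n rule: less_induct)
    case (less n)
    have row: "M n k = 0" if k: "k \<in> {n..d}" for k
    proof (cases "n + b < k")
      case True
      then show ?thesis using band k by simp
    next
      case False
      \<comment> \<open>In row \<open>n\<close>, the columns before \<open>n\<close> vanish by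
        induction and those after \<open>n + b\<close> by the band condition, so only the columns in
        \<open>T\<close> remain.\<close>
      define T where "T = {n..n + b} \<inter> {..d}"
      have T: "finite T" "inj_on \<theta> T" "k \<in> T" "T \<subseteq> {..d}"
        using k False inj by (auto simp: T_def inj_on_def)
      have "card T \<le> card {n..n + b}" by (intro card_mono) (auto simp: T_def)
      then have "low_degree (Suc b) (lagrange \<theta> T k)"
        using degree_lagrange[of T k \<theta>] T by (intro low_degreeI) simp
      then have "0 = (\<Sum>i\<le>d. \<Sum>j\<le>d. poly (lagrange \<theta> {..d} n) (\<theta> i) *
          poly (lagrange \<theta> T k) (\<theta> j) * M i j)"
        using orth by simp
      also have "\<dots> = (\<Sum>i\<le>d. poly (lagrange \<theta> {..d} n) (\<theta> i) *
          (\<Sum>j\<le>d. poly (lagrange \<theta> T k) (\<theta> j) * M i j))"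
        by (simp add: sum_distrib_left mult.assoc)
      also have "\<dots> = (\<Sum>j\<le>d. poly (lagrange \<theta> T k) (\<theta> j) * M n j)"
        using k inj by (intro sum_lagrange) auto
      also have "\<dots> = (\<Sum>j\<in>T. poly (lagrange \<theta> T k) (\<theta> j) * M n j)"
      proof (intro sum.mono_neutral_right ballI)
        fix j assume j: "j \<in> {..d} - T"
        then have "j < n \<or> n + b < j" by (auto simp: T_def)
        then have "M n j = 0" using less.IH[of j] band[of n j] j k by auto
        then show "poly (lagrange \<theta> T k) (\<theta> j) * M n j = 0" by simp
      qed (use T in auto)
      also have "\<dots> = M n k" using T by (intro sum_lagrange) auto
      finally show ?thesis by simp
    qed
    have col: "M k n = 0" if k: "k \<in> {n..d}" for k
    proof (cases "k = n \<or> n + b < k")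
      case True
      then show ?thesis using row band k by auto
    next
      case False
      \<comment> \<open>The diagonal entry is known from the row step. One node fewer lowers the
        degree bound by one; hence the asymmetric hypothesis on \<open>p\<close> and
        \<open>q\<close>.\<close>
      define T where "T = {Suc n..n + b} \<inter> {..d}"
      have T: "finite T" "inj_on \<theta> T" "k \<in> T" "T \<subseteq> {..d}"
        using k False inj by (auto simp: T_def inj_on_def)
      have "card T \<le> card {Suc n..n + b}" by (intro card_mono) (auto simp: T_def)
      then have "low_degree b (lagrange \<theta> T k)"
        using degree_lagrange[of T k \<theta>] T by (intro low_degreeI) simp
      then have "0 = (\<Sum>i\<le>d. \<Sum>j\<le>d. poly (lagrange \<theta> T k) (\<theta> i) *
          poly (lagrange \<theta> {..d} n) (\<theta> j) * M i j)"
        using orth by simp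
      also have "\<dots> = (\<Sum>i\<le>d. poly (lagrange \<theta> T k) (\<theta> i) *
          (\<Sum>j\<le>d. poly (lagrange \<theta> {..d} n) (\<theta> j) * M i j))"
        by (simp add: sum_distrib_left mult.assoc)
      also have "\<dots> = (\<Sum>i\<le>d. poly (lagrange \<theta> T k) (\<theta> i) * M i n)"
        using k inj by (simp add: sum_lagrange)
      also have "\<dots> = (\<Sum>i\<in>T. poly (lagrange \<theta> T k) (\<theta> i) * M i n)"
      proof (intro sum.mono_neutral_right ballI)
        fix i assume i: "i \<in> {..d} - T"
        then have "i \<le> n \<or> n + b < i" by (auto simp: T_def)
        then have "M i n = 0" using less.IH[of i] band[of i n] row[of n] i k by (auto simp: le_less)
        then show "poly (lagrange \<theta> T k) (\<theta> i) * M i n = 0" by simp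
      qed (use T in auto)
      also have "\<dots> = M k n" using T by (intro sum_lagrange) auto
      finally show ?thesis by simp
    qed
    show ?case using row col by blast
  qed
  \<comment> \<open>The entry \<open>M i j\<close> lies in row \<open>i\<close> if
    \<open>i \<le> j\<close> and in column \<open>j\<close> otherwise, so the minimum of the indices
    serves as \<open>n\<close>.\<close>
  then show ?thesis using assms(4,5) by (metis atLeastAtMost_iff nat_le_linear)
qed

subsection \<open>Linear maps, linear forms and adjoints\<close>

locale finite_dimensional_operators = finite_dimensional_vector_space scale Basis
  for scale :: "'a::field \<Rightarrow> 'b::ab_group_add \<Rightarrow> 'b" (infixr "*s" 75) and Basis :: "'b set"
begin

lemma EndoI: "(\<And>u v. X (u + v) = X u + X v) \<Longrightarrow> (\<And>c v. X (c *s v) = c *s X v) \<Longrightarrow> X \<in> Endo"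
  by (simp add: Endo_def Vector_Spaces.linear_iff vector_space_axioms)

lemma
  assumes "X \<in> Endo"
  shows Endo_add: "X (u + v) = X u + X v"
    and Endo_scale: "X (c *s v) = c *s X v"
  using assms by (simp_all add: Endo_def Vector_Spaces.linear_iff)

lemma Endo_0: "X \<in> Endo \<Longrightarrow> X 0 = 0"
  using Endo_scale[of X 0 0] by simp

lemma Endo_sum: "X \<in> Endo \<Longrightarrow> X (\<Sum>i\<in>I. g i) = (\<Sum>i\<in>I. X (g i))"
  by (induction I rule: infinite_finite_induct) (simp_all add: Endo_0 Endo_add)

lemma Endo_comp: "X \<in> Endo \<Longrightarrow> Y \<in> Endo \<Longrightarrow> X \<circ> Y \<in> Endo"
  by (intro EndoI) (simp_all add: Endo_add Endo_scale)

lemma Endo_id: "id \<in> Endo"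
  by (intro EndoI) simp_all

lemma Endo_eq_on_span:
  assumes "X \<in> Endo" "Y \<in> Endo" "\<And>v. v \<in> S \<Longrightarrow> X v = Y v" "v \<in> span S"
  shows "X v = Y v"
  using assms(4)
proof (induction rule: span_induct_alt)
  case base
  then show ?case using assms by (simp add: Endo_0)
next
  case (step c x y)
  then show ?case using assms by (simp add: Endo_add Endo_scale)
qed

definition functional :: "('b \<Rightarrow> 'a) \<Rightarrow> bool" where
  "functional f \<longleftrightarrow> (\<forall>u v. f (u + v) = f u + f v) \<and> (\<forall>c v. f (c *s v) = c * f v)"

lemma
  assumes "functional f"
  shows functional_add: "f (u + v) = f u + f v"
    and functional_scale: "f (c *s v) = c * f v"
  using assms by (simp_all add: functional_def)

lemma functional_0: "functional f \<Longrightarrow> f 0 = 0"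
  using functional_scale[of f 0 0] by simp

lemma functional_sum: "functional f \<Longrightarrow> f (\<Sum>i\<in>I. g i) = (\<Sum>i\<in>I. f (g i))"
  by (induction I rule: infinite_finite_induct) (simp_all add: functional_0 functional_add)

lemma functional_comp_Endo: "functional f \<Longrightarrow> X \<in> Endo \<Longrightarrow> functional (f \<circ> X)"
  by (simp add: functional_def Endo_add Endo_scale)

lemma functional_eq_on_span:
  assumes "functional f" "functional g" "\<And>v. v \<in> S \<Longrightarrow> f v = g v" "v \<in> span S"
  shows "f v = g v"
  using assms(4)
proof (induction rule: span_induct_alt)
  case base
  then show ?case using assms by (simp add: functional_0)
next
  case (step c x y)
  then show ?case using assms by (simp add: functional_add functional_scale)
qed

lemma sum_Basis_representation: "(\<Sum>b\<in>Basis. representation Basis v b *s b) = v"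
  using sum_representation_eq[OF independent_Basis, of v Basis] by (simp add: span_Basis finite_Basis)

lemma functional_representation: "independent C \<Longrightarrow> span C = UNIV \<Longrightarrow> functional (\<lambda>v. representation C v b)"
  by (simp add: functional_def representation_add representation_scale)

lemma Basis_coefficients_eq:
  assumes "(\<Sum>b\<in>Basis. x b *s b) = (\<Sum>b\<in>Basis. y b *s b)" "b \<in> Basis"
  shows "x b = y b"
proof -
  have "(\<Sum>b\<in>Basis. (x b - y b) *s b) = 0"
    using assms(1) by (simp add: scale_left_diff_distrib sum_subtractf)
  then have "x b - y b = 0"
    by (rule independentD[OF independent_Basis finite_Basis subset_refl _ assms(2)])
  then show ?thesis by simp
qed

section \<open>Adjoints with respect to a nondegenerate symmetric form\<close>

definition nondegenerate_symmetric_form :: "('b \<Rightarrow> 'b \<Rightarrow> 'a) \<Rightarrow> bool" where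
  "nondegenerate_symmetric_form \<beta> \<longleftrightarrow> (\<forall>u. functional (\<beta> u)) \<and>
    (\<forall>u v. \<beta> u v = \<beta> v u) \<and> (\<forall>v. (\<forall>u. \<beta> u v = 0) \<longrightarrow> v = 0)"

context
  fixes \<beta> :: "'b \<Rightarrow> 'b \<Rightarrow> 'a"
  assumes form: "nondegenerate_symmetric_form \<beta>"
begin

lemma form_right: "functional (\<beta> u)"
  and form_sym: "\<beta> u v = \<beta> v u"
  and form_nondegenerate: "(\<And>u. \<beta> u v = 0) \<Longrightarrow> v = 0"
  using form unfolding nondegenerate_symmetric_form_def by blast+

lemma form_left: "functional (\<lambda>u. \<beta> u v)"
  using form_right[of v] by (simp add: form_sym[of _ v])

lemma form_eqI:
  assumes "\<And>v. \<beta> u v = \<beta> u' v"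
  shows "u = u'"
proof -
  have "\<beta> w (u - u') = 0" for w
  proof -
    have "\<beta> w u = \<beta> w u'" using assms by (simp add: form_sym[of w])
    then show ?thesis
      using functional_add[OF form_right, of w "u - u'" u'] by simp
  qed
  then show ?thesis using form_nondegenerate[of "u - u'"] by simp
qed

lemma functional_represented:
  assumes g: "functional g"
  obtains w where "\<And>v. \<beta> w v = g v"
proof -
  \<comment> \<open>Placing the numbers \<open>\<beta> b v\<close> as coordinates back into the same
    space makes \<open>G\<close> an endomorphism, so injectivity, which is nondegeneracy, gives
    surjectivity.\<close>
  define G where "G v = (\<Sum>b\<in>Basis. \<beta> b v *s b)" for v
  have "G \<in> Endo"
    by (intro EndoI) (simp_all add: G_def functional_add[OF form_right] functional_scale[OF form_right]
        scale_left_distrib sum.distrib scale_sum_right)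
  moreover have "inj G"
  proof (rule injI)
    fix u v assume "G u = G v"
    then have eq: "\<beta> b u = \<beta> b v" if "b \<in> Basis" for b
      unfolding G_def by (rule Basis_coefficients_eq[OF _ that])
    show "u = v"
    proof (rule form_eqI)
      fix w show "\<beta> u w = \<beta> v w"
        by (rule functional_eq_on_span[OF form_right form_right, of Basis]) (use eq form_sym in \<open>auto simp: span_Basis\<close>)
    qed
  qed
  ultimately have "surj G"
    by (intro linear_inj_imp_surj) (simp_all add: Endo_def)
  then obtain w where "G w = (\<Sum>b\<in>Basis. g b *s b)" by (metis surj_def)
  then have eq: "\<beta> b w = g b" if "b \<in> Basis" for b
    unfolding G_def by (rule Basis_coefficients_eq[OF _ that])
  have "\<beta> w v = g v" for v
    by (rule functional_eq_on_span[OF form_right g, of Basis]) (use eq form_sym in \<open>auto simp: span_Basis\<close>)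
  then show ?thesis using that by blast
qed

text \<open>For linear \<open>X\<close> a suitable \<open>w\<close> exists by
  \<open>functional_represented\<close> and is unique by \<open>form_eqI\<close>, so the choice is
  forced.\<close>

definition adjoint :: "('b \<Rightarrow> 'b) \<Rightarrow> 'b \<Rightarrow> 'b" where
  "adjoint X u = (SOME w. \<forall>v. \<beta> w v = \<beta> u (X v))"

lemma form_adjoint:
  assumes "X \<in> Endo"
  shows "\<beta> (adjoint X u) v = \<beta> u (X v)"
proof -
  have "functional (\<lambda>v. \<beta> u (X v))"
    using functional_comp_Endo[OF form_right assms, of u] by (simp add: o_def)
  then obtain w where "\<And>v. \<beta> w v = \<beta> u (X v)" by (rule functional_represented) blast
  then have "\<exists>w. \<forall>v. \<beta> w v = \<beta> u (X v)" by blast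
  then show ?thesis unfolding adjoint_def by (rule someI_ex[THEN spec])
qed

lemma adjoint_Endo: "X \<in> Endo \<Longrightarrow> adjoint X \<in> Endo"
  by (intro EndoI; rule form_eqI)
    (simp_all add: form_adjoint functional_add[OF form_left] functional_scale[OF form_left])

lemma adjoint_eqI:
  assumes "X \<in> Endo" "\<And>u v. \<beta> (Y u) v = \<beta> u (X v)"
  shows "adjoint X = Y"
  by (rule ext, rule form_eqI) (simp add: assms form_adjoint)

lemma adjoint_adjoint: "X \<in> Endo \<Longrightarrow> adjoint (adjoint X) = X"
proof (rule adjoint_eqI[OF adjoint_Endo])
  fix u v assume X: "X \<in> Endo"
  have "\<beta> (X u) v = \<beta> v (X u)" by (rule form_sym)
  also have "\<dots> = \<beta> (adjoint X v) u" by (rule form_adjoint[OF X, symmetric])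
  also have "\<dots> = \<beta> u (adjoint X v)" by (rule form_sym)
  finally show "\<beta> (X u) v = \<beta> u (adjoint X v)" .
qed

lemma adjoint_anti_automorphism: "anti_automorphism (restrict adjoint Endo)"
proof -
  have "bij_betw (restrict adjoint Endo) Endo Endo"
    by (rule bij_betwI[where g = "restrict adjoint Endo"]) (auto simp: adjoint_Endo adjoint_adjoint)
  moreover have "adjoint (\<lambda>v. X v + Y v) = (\<lambda>v. adjoint X v + adjoint Y v) \<and> (\<lambda>v. X v + Y v) \<in> Endo"
    if "X \<in> Endo" "Y \<in> Endo" for X Y
  proof
    show *: "(\<lambda>v. X v + Y v) \<in> Endo"
      using that by (intro EndoI) (simp_all add: Endo_add Endo_scale algebra_simps)
    show "adjoint (\<lambda>v. X v + Y v) = (\<lambda>v. adjoint X v + adjoint Y v)"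
      by (rule adjoint_eqI[OF *]) (simp add: functional_add[OF form_left] functional_add[OF form_right] form_adjoint that)
  qed
  moreover have "adjoint (\<lambda>v. c *s X v) = (\<lambda>v. c *s adjoint X v) \<and> (\<lambda>v. c *s X v) \<in> Endo"
    if "X \<in> Endo" for c X
  proof
    show *: "(\<lambda>v. c *s X v) \<in> Endo"
      using that by (intro EndoI) (simp_all add: Endo_add Endo_scale algebra_simps)
    show "adjoint (\<lambda>v. c *s X v) = (\<lambda>v. c *s adjoint X v)"
      by (rule adjoint_eqI[OF *]) (simp add: functional_scale[OF form_left] functional_scale[OF form_right] form_adjoint that)
  qed
  moreover have "adjoint (X \<circ> Y) = adjoint Y \<circ> adjoint X" if "X \<in> Endo" "Y \<in> Endo" for X Y
    by (rule adjoint_eqI[OF Endo_comp[OF that]]) (simp add: form_adjoint that)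
  ultimately show ?thesis
    unfolding anti_automorphism_def by (simp add: Endo_comp)
qed

end

text \<open>Preservation of \<open>id\<close> follows from surjectivity: if
  \<open>\<sigma> J = id\<close>, then applying \<open>\<sigma>\<close> to
  \<open>J \<circ> id = J\<close> gives \<open>\<sigma> id = id\<close>.\<close>

lemma anti_automorphism_id:
  assumes "anti_automorphism \<sigma>"
  shows "\<sigma> id = id"
proof -
  have "id \<in> \<sigma> ` Endo" using assms Endo_id by (auto simp: anti_automorphism_def bij_betw_def)
  then obtain J where "J \<in> Endo" "\<sigma> J = id" by auto
  moreover from this have "\<sigma> (J \<circ> id) = \<sigma> id \<circ> \<sigma> J"
    using assms Endo_id unfolding anti_automorphism_def by blast
  ultimately show ?thesis by simp
qed

subsection \<open>Polynomials in a map acting tridiagonally\<close>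

text \<open>This is \<open>p(A)\<close>, evaluated by Horner's rule.\<close>

definition poly_op :: "('b \<Rightarrow> 'b) \<Rightarrow> 'a poly \<Rightarrow> 'b \<Rightarrow> 'b" where
  "poly_op A p = fold_coeffs (\<lambda>a g v. a *s v + A (g v)) p (\<lambda>v. 0)"

lemma poly_op_0 [simp]: "poly_op A 0 = (\<lambda>v. 0)"
  by (simp add: poly_op_def)

lemma poly_op_pCons:
  assumes "A \<in> Endo"
  shows "poly_op A (pCons a p) v = a *s v + A (poly_op A p v)"
  by (cases "p = 0 \<and> a = 0") (use assms in \<open>auto simp: poly_op_def Endo_0\<close>)

lemma poly_op_1: "A \<in> Endo \<Longrightarrow> poly_op A 1 v = v"
  by (simp add: one_pCons poly_op_pCons Endo_0)

lemma poly_op_X: "A \<in> Endo \<Longrightarrow> poly_op A [:0, 1:] v = A v"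
  by (simp add: poly_op_pCons Endo_0)

lemma poly_op_Endo: "A \<in> Endo \<Longrightarrow> poly_op A p \<in> Endo"
proof (induction p)
  case 0
  then show ?case by (intro EndoI) simp_all
next
  case (pCons a p)
  then show ?case
    by (intro EndoI) (simp_all add: poly_op_pCons Endo_add Endo_scale algebra_simps)
qed

lemma poly_op_add: "A \<in> Endo \<Longrightarrow> poly_op A (p + q) v = poly_op A p v + poly_op A q v"
  by (induction p q rule: poly_induct2) (simp_all add: poly_op_pCons Endo_add algebra_simps)

lemma poly_op_eigenvector:
  "A \<in> Endo \<Longrightarrow> A v = t *s v \<Longrightarrow> poly_op A p v = poly p t *s v"
  by (induction p) (simp_all add: poly_op_pCons Endo_scale algebra_simps)

section \<open>Eigenprojections and the band property\<close>

definition eigenspace :: "('b \<Rightarrow> 'b) \<Rightarrow> 'a \<Rightarrow> 'b set" where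
  "eigenspace A t = {v. A v = t *s v}"

text \<open>One half of the tridiagonal condition, indexed by eigenvalues; it is used for both
  orders of the pair. The \<open>Suc\<close> inequalities say that \<open>i\<close> and
  \<open>j\<close> differ by at most one without truncated subtraction.\<close>

definition tridiagonal_on :: "('b \<Rightarrow> 'b) \<Rightarrow> ('b \<Rightarrow> 'b) \<Rightarrow> nat \<Rightarrow> (nat \<Rightarrow> 'a) \<Rightarrow> bool" where
  "tridiagonal_on A B d \<theta> \<longleftrightarrow> A \<in> Endo \<and> B \<in> Endo \<and> inj_on \<theta> {..d} \<and>
    span (\<Union>i\<le>d. eigenspace A (\<theta> i)) = UNIV \<and>
    (\<forall>i\<le>d. B ` eigenspace A (\<theta> i) \<subseteq> span (\<Union>j\<in>{j. j \<le> d \<and> j \<le> Suc i \<and> i \<le> Suc j}. eigenspace A (\<theta> j)))"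

text \<open>Writing the primitive idempotent as a polynomial in \<open>A\<close> places it in the
  algebra generated by \<open>A\<close>.\<close>

definition eigenproj :: "('b \<Rightarrow> 'b) \<Rightarrow> nat \<Rightarrow> (nat \<Rightarrow> 'a) \<Rightarrow> nat \<Rightarrow> 'b \<Rightarrow> 'b" where
  "eigenproj A d \<theta> i = poly_op A (lagrange \<theta> {..d} i)"

context
  fixes A B :: "'b \<Rightarrow> 'b" and d :: nat and \<theta> :: "nat \<Rightarrow> 'a"
  assumes tri: "tridiagonal_on A B d \<theta>"
begin

lemma tri_Endo: "A \<in> Endo" "B \<in> Endo"
  and tri_inj: "inj_on \<theta> {..d}"
  and tri_span: "span (\<Union>i\<le>d. eigenspace A (\<theta> i)) = UNIV"
  and tri_step: "i \<le> d \<Longrightarrow> v \<in> eigenspace A (\<theta> i) \<Longrightarrow>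
    B v \<in> span (\<Union>j\<in>{j. j \<le> d \<and> j \<le> Suc i \<and> i \<le> Suc j}. eigenspace A (\<theta> j))"
  using tri by (auto simp: tridiagonal_on_def)

lemma eigenproj_Endo: "eigenproj A d \<theta> i \<in> Endo"
  unfolding eigenproj_def by (intro poly_op_Endo tri_Endo)

lemma Endo_eqI_eigenvectors:
  assumes "X \<in> Endo" "Y \<in> Endo" "\<And>i v. i \<le> d \<Longrightarrow> A v = \<theta> i *s v \<Longrightarrow> X v = Y v"
  shows "X v = Y v"
proof (rule Endo_eq_on_span[OF assms(1,2)])
  show "v \<in> span (\<Union>i\<le>d. eigenspace A (\<theta> i))" by (simp add: tri_span)
qed (use assms(3) in \<open>auto simp: eigenspace_def\<close>)

lemma eigenproj_eigenvector:
  assumes "j \<le> d" "i \<le> d" "A v = \<theta> j *s v"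
  shows "eigenproj A d \<theta> i v = (if j = i then v else 0)"
  using assms tri_inj
  by (simp add: eigenproj_def poly_op_eigenvector[OF tri_Endo(1) assms(3)] poly_lagrange)

lemma eigenproj_in_eigenspace:
  assumes "i \<le> d"
  shows "A (eigenproj A d \<theta> i v) = \<theta> i *s eigenproj A d \<theta> i v"
proof -
  have "(A \<circ> eigenproj A d \<theta> i) v = (\<lambda>v. \<theta> i *s eigenproj A d \<theta> i v) v"
  proof (rule Endo_eqI_eigenvectors[where Y = "\<lambda>v. \<theta> i *s eigenproj A d \<theta> i v"])
    show "A \<circ> eigenproj A d \<theta> i \<in> Endo" by (intro Endo_comp tri_Endo eigenproj_Endo)
    show "(\<lambda>v. \<theta> i *s eigenproj A d \<theta> i v) \<in> Endo"
      by (intro EndoI) (simp_all add: Endo_add Endo_scale eigenproj_Endo algebra_simps)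
  qed (use assms in \<open>auto simp: eigenproj_eigenvector tri_Endo Endo_0\<close>)
  then show ?thesis by simp
qed

text \<open>Both sides are linear and agree on eigenvectors, which span the space.\<close>

lemma poly_op_eq_sum_eigenproj:
  "poly_op A p v = (\<Sum>i\<le>d. poly p (\<theta> i) *s eigenproj A d \<theta> i v)"
proof (rule Endo_eqI_eigenvectors[where Y = "\<lambda>v. \<Sum>i\<le>d. poly p (\<theta> i) *s eigenproj A d \<theta> i v"])
  show "poly_op A p \<in> Endo" by (intro poly_op_Endo tri_Endo)
  show "(\<lambda>v. \<Sum>i\<le>d. poly p (\<theta> i) *s eigenproj A d \<theta> i v) \<in> Endo"
    by (intro EndoI) (simp_all add: Endo_add Endo_scale eigenproj_Endo scale_right_distrib
        sum.distrib scale_sum_right mult.commute)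
next
  fix j v assume j: "j \<le> d" "A v = \<theta> j *s v"
  have "(\<Sum>i\<le>d. poly p (\<theta> i) *s eigenproj A d \<theta> i v) = (\<Sum>i\<le>d. if i = j then poly p (\<theta> i) *s v else 0)"
    using j by (intro sum.cong) (auto simp: eigenproj_eigenvector)
  then show "poly_op A p v = (\<Sum>i\<le>d. poly p (\<theta> i) *s eigenproj A d \<theta> i v)"
    using j by (simp add: poly_op_eigenvector[OF tri_Endo(1)])
qed

text \<open>Each application of \<open>B\<close> changes the eigenspace index by at most
  one.\<close>

lemma poly_op_other_band:
  assumes "j \<le> d" "A v = \<theta> j *s v" "degree q \<le> b"
  shows "poly_op B q v \<in> span (\<Union>k\<in>{k. k \<le> d \<and> k \<le> j + b \<and> j \<le> k + b}. eigenspace A (\<theta> k))"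
  using assms(3)
proof (induction q arbitrary: b)
  case 0
  then show ?case by (simp add: span_zero)
next
  case (pCons a q)
  define S where "S b = (\<Union>k\<in>{k. k \<le> d \<and> k \<le> j + b \<and> j \<le> k + b}. eigenspace A (\<theta> k))" for b
  have v: "v \<in> span (S b)" for b
    using assms by (intro span_base) (auto simp: S_def eigenspace_def)
  have "B (poly_op B q v) \<in> span (S b)"
  \<comment> \<open>A constant polynomial allows \<open>b = 0\<close>, where no smaller bound
    \<open>c\<close> exists.\<close>
  proof (cases "q = 0")
    case True
    then show ?thesis by (simp add: Endo_0 tri_Endo span_zero)
  next
    case False
    then obtain c where c: "b = Suc c" "degree q \<le> c"
      using pCons.prems by (cases b) auto
    have "poly_op B q v \<in> span (S c)" using pCons.IH[OF c(2)] by (simp add: S_def)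
    then show ?thesis
    proof (induction rule: span_induct_alt)
      case base
      then show ?case by (simp add: Endo_0 tri_Endo span_zero)
    next
      case (step x w y)
      then obtain k where k: "k \<le> d" "k \<le> j + c" "j \<le> k + c" "w \<in> eigenspace A (\<theta> k)"
        by (auto simp: S_def)
      have "span (\<Union>l\<in>{l. l \<le> d \<and> l \<le> Suc k \<and> k \<le> Suc l}. eigenspace A (\<theta> l)) \<subseteq> span (S b)"
        using k c by (intro span_mono) (force simp: S_def)
      with k tri_step[OF k(1,4)] have "B w \<in> span (S b)" by auto
      with step show ?case
        by (simp add: Endo_add Endo_scale tri_Endo span_add span_scale)
    qed
  qed
  with v[of b] show ?case
    unfolding S_def[symmetric] by (simp add: poly_op_pCons tri_Endo span_add span_scale)
qed

lemma eigenproj_poly_op_eigenproj: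
  assumes "i \<le> d" "j \<le> d" "degree q \<le> b" "i + b < j \<or> j + b < i"
  shows "eigenproj A d \<theta> i (poly_op B q (eigenproj A d \<theta> j v)) = 0"
proof -
  have "poly_op B q (eigenproj A d \<theta> j v)
      \<in> span (\<Union>k\<in>{k. k \<le> d \<and> k \<le> j + b \<and> j \<le> k + b}. eigenspace A (\<theta> k))"
    using assms by (intro poly_op_other_band eigenproj_in_eigenspace)
  then show ?thesis
  proof (induction rule: span_induct_alt)
    case base
    then show ?case by (simp add: Endo_0 eigenproj_Endo)
  next
    case (step c x y)
    then obtain k where "k \<le> d" "k \<le> j + b" "j \<le> k + b" "A x = \<theta> k *s x"
      by (auto simp: eigenspace_def)
    then have "eigenproj A d \<theta> i x = 0" using assms by (auto simp: eigenproj_eigenvector)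
    with step show ?case by (simp add: Endo_add Endo_scale eigenproj_Endo)
  qed
qed

text \<open>The span of the operators \<open>p(A) q(B) r(A)\<close> is already obtained from those with
  \<open>deg p < b\<close> or \<open>deg r \<le> b\<close>, where \<open>b \<ge> deg q\<close>, by the same linear relations for the
  reversed products; this is expressed through the functionals \<open>f\<close> and \<open>g\<close>.\<close>

lemma sandwich_reduction:
  assumes f: "functional f" and g: "functional g" and q: "degree q \<le> b"
    and red: "\<And>p r. low_degree b p \<or> low_degree (Suc b) r \<Longrightarrow>
      f (poly_op A p (poly_op B q (poly_op A r x))) = g (poly_op A r (poly_op B q (poly_op A p y)))"
  shows "f (poly_op A p (poly_op B q (poly_op A r x))) = g (poly_op A r (poly_op B q (poly_op A p y)))"
proof -
  let ?E = "eigenproj A d \<theta>"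
  \<comment> \<open>\<open>M\<close> measures the failure of the identity on pairs of
    eigenprojections. Its entries are scalars, and \<open>p\<close> and \<open>r\<close> enter the
    total defect only through their values at eigenvalues, as \<open>band_matrix_eq_0\<close>
    requires.\<close>
  define M where "M i j = f (?E i (poly_op B q (?E j x))) - g (?E j (poly_op B q (?E i y)))" for i j
  note lin = functional_sum functional_scale Endo_sum Endo_scale poly_op_Endo tri_Endo eigenproj_Endo
  have expand: "f (poly_op A p (poly_op B q (poly_op A r x))) - g (poly_op A r (poly_op B q (poly_op A p y)))
      = (\<Sum>i\<le>d. \<Sum>j\<le>d. poly p (\<theta> i) * poly r (\<theta> j) * M i j)" for p r
  proof -
    have "f (poly_op A p (poly_op B q (poly_op A r x)))
        = (\<Sum>i\<le>d. \<Sum>j\<le>d. poly p (\<theta> i) * poly r (\<theta> j) * f (?E i (poly_op B q (?E j x))))"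
      by (simp add: poly_op_eq_sum_eigenproj[of p] poly_op_eq_sum_eigenproj[of r] f lin
          sum_distrib_left mult.assoc)
    moreover have "g (poly_op A r (poly_op B q (poly_op A p y)))
        = (\<Sum>j\<le>d. \<Sum>i\<le>d. poly p (\<theta> i) * poly r (\<theta> j) * g (?E j (poly_op B q (?E i y))))"
      by (simp add: poly_op_eq_sum_eigenproj[of p] poly_op_eq_sum_eigenproj[of r] g lin
          sum_distrib_left mult_ac)
    moreover have "\<dots> = (\<Sum>i\<le>d. \<Sum>j\<le>d. poly p (\<theta> i) * poly r (\<theta> j) * g (?E j (poly_op B q (?E i y))))"
      by (rule sum.swap)
    ultimately show ?thesis
      by (simp add: M_def sum_subtractf right_diff_distrib)
  qed
  have "M i j = 0" if "i \<le> d" "j \<le> d" for i j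
  proof (rule band_matrix_eq_0[OF tri_inj _ _ that, where b = b])
    fix i j assume "i \<le> d" "j \<le> d" "i + b < j \<or> j + b < i"
    then show "M i j = 0"
      unfolding M_def using eigenproj_poly_op_eigenproj[OF _ _ q] f g
      by (simp add: functional_0 disj_commute)
  next
    fix p r :: "'a poly" assume "low_degree b p \<or> low_degree (Suc b) r"
    then show "(\<Sum>i\<le>d. \<Sum>j\<le>d. poly p (\<theta> i) * poly r (\<theta> j) * M i j) = 0"
      using red by (simp flip: expand)
  qed
  then have "(\<Sum>i\<le>d. \<Sum>j\<le>d. poly p (\<theta> i) * poly r (\<theta> j) * M i j) = 0" by simp
  then show ?thesis by (simp flip: expand)
qed

end

subsection \<open>Reversal of words\<close>

text \<open>The operators trade places at each letter. A word of odd length begins and ends with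
  \<open>B\<close>, so reversing the list reverses the product.\<close>

primrec alt_word :: "'a poly list \<Rightarrow> ('b \<Rightarrow> 'b) \<Rightarrow> ('b \<Rightarrow> 'b) \<Rightarrow> 'b \<Rightarrow> 'b" where
  "alt_word [] B C = id"
| "alt_word (p # ps) B C = poly_op B p \<circ> alt_word ps C B"

lemma alt_word_append:
  "alt_word (ps @ qs) B C =
    alt_word ps B C \<circ> (if even (length ps) then alt_word qs B C else alt_word qs C B)"
  by (induction ps arbitrary: B C) (simp_all add: o_assoc)

lemma alt_word_Endo: "B \<in> Endo \<Longrightarrow> C \<in> Endo \<Longrightarrow> alt_word ps B C \<in> Endo"
  by (induction ps arbitrary: B C) (simp_all add: Endo_id Endo_comp poly_op_Endo)

lemma alt_word_eq_0: "B \<in> Endo \<Longrightarrow> C \<in> Endo \<Longrightarrow> 0 \<in> set ps \<Longrightarrow> alt_word ps B C v = 0"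
  by (induction ps arbitrary: B C) (auto simp: Endo_0 poly_op_Endo)

context
  fixes A A' :: "'b \<Rightarrow> 'b" and d \<delta> :: nat and \<theta> \<theta>' :: "nat \<Rightarrow> 'a"
    and f :: "'b \<Rightarrow> 'a" and v\<^sub>0 :: 'b
  assumes tri: "tridiagonal_on A A' d \<theta>" and tri': "tridiagonal_on A' A \<delta> \<theta>'"
    and v0: "A v\<^sub>0 = \<theta> 0 *s v\<^sub>0" "v\<^sub>0 \<noteq> 0"
    and f: "functional f" "\<And>v. eigenproj A d \<theta> 0 v = f v *s v\<^sub>0"
    and irred: "\<And>W. subspace W \<Longrightarrow> A ` W \<subseteq> W \<Longrightarrow> A' ` W \<subseteq> W \<Longrightarrow> W = {0} \<or> W = UNIV"
begin

lemmas E_A = tri_Endo[OF tri]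

lemma eigenproj_v0: "eigenproj A d \<theta> 0 v\<^sub>0 = v\<^sub>0"
  by (simp add: eigenproj_eigenvector[OF tri _ _ v0(1)])

lemma f_v0: "f v\<^sub>0 = 1"
  using f(2)[of v\<^sub>0] v0(2) scale_right_imp_eq[of v\<^sub>0 "f v\<^sub>0" 1] by (simp add: eigenproj_v0)

lemma f_eigenproj: "f (eigenproj A d \<theta> 0 v) = f v"
  by (simp add: f functional_scale f_v0)

text \<open>The map \<open>p(A')\<close> sends \<open>v\<^sub>0\<close> into the sum of the
  eigenspaces with index at most \<open>m\<close>. All of these but the one of index 0 are killed by
  \<open>s(A)\<close>, and \<open>f\<close> reads off the coefficient there. The second claim is the
  mirror image, since \<open>f\<close> is unchanged by the projection of index 0.\<close>

lemma poly_op_last_slot: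
  assumes p: "degree p \<le> m" and s: "\<And>i. i \<in> {1..m} \<Longrightarrow> poly s (\<theta> i) = 0"
  shows "poly_op A s (poly_op A' p v\<^sub>0) = (poly s (\<theta> 0) * f (poly_op A' p v\<^sub>0)) *s v\<^sub>0"
    and "f (poly_op A' p (poly_op A s w)) = poly s (\<theta> 0) * f (poly_op A' p v\<^sub>0) * f w"
proof -
  let ?E = "eigenproj A d \<theta>"
  note lin = Endo_sum Endo_scale eigenproj_Endo[OF tri] poly_op_Endo E_A
  have "poly_op A s (poly_op A' p v\<^sub>0) = (\<Sum>i\<le>d. poly s (\<theta> i) *s ?E i (poly_op A' p (?E 0 v\<^sub>0)))"
    by (simp add: poly_op_eq_sum_eigenproj[OF tri, of s] eigenproj_v0)
  also have "\<dots> = (\<Sum>i\<in>{0}. poly s (\<theta> i) *s ?E i (poly_op A' p (?E 0 v\<^sub>0)))"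
  proof (intro sum.mono_neutral_right ballI)
    fix i assume i: "i \<in> {..d} - {0}"
    show "poly s (\<theta> i) *s ?E i (poly_op A' p (?E 0 v\<^sub>0)) = 0"
    proof (cases "i \<le> m")
      case True
      then show ?thesis using s i by auto
    next
      case False
      then show ?thesis using eigenproj_poly_op_eigenproj[OF tri _ _ p, of i 0] i by auto
    qed
  qed auto
  finally show "poly_op A s (poly_op A' p v\<^sub>0) = (poly s (\<theta> 0) * f (poly_op A' p v\<^sub>0)) *s v\<^sub>0"
    by (simp add: f(2)[symmetric] eigenproj_v0) (simp add: f(2))
  have "f (poly_op A' p (poly_op A s w)) = f (?E 0 (poly_op A' p (poly_op A s w)))"
    by (simp add: f_eigenproj)
  also have "?E 0 (poly_op A' p (poly_op A s w)) = (\<Sum>i\<le>d. poly s (\<theta> i) *s ?E 0 (poly_op A' p (?E i w)))"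
    by (simp add: poly_op_eq_sum_eigenproj[OF tri, of s] lin)
  also have "\<dots> = (\<Sum>i\<in>{0}. poly s (\<theta> i) *s ?E 0 (poly_op A' p (?E i w)))"
  proof (intro sum.mono_neutral_right ballI)
    fix i assume i: "i \<in> {..d} - {0}"
    show "poly s (\<theta> i) *s ?E 0 (poly_op A' p (?E i w)) = 0"
    proof (cases "i \<le> m")
      case True
      then show ?thesis using s i by auto
    next
      case False
      then show ?thesis using eigenproj_poly_op_eigenproj[OF tri _ _ p, of 0 i] i by auto
    qed
  qed auto
  also have "f \<dots> = poly s (\<theta> 0) * f (poly_op A' p (?E 0 w))"
    by (simp add: f(1) functional_scale f_eigenproj)
  also have "\<dots> = poly s (\<theta> 0) * f (poly_op A' p v\<^sub>0) * f w"
    by (simp add: f functional_scale lin)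
  finally show "f (poly_op A' p (poly_op A s w)) = poly s (\<theta> 0) * f (poly_op A' p v\<^sub>0) * f w" .
qed

definition reversible :: "'a poly list \<Rightarrow> bool" where
  "reversible ps \<longleftrightarrow> f (alt_word ps A' A v\<^sub>0) = f (alt_word (rev ps) A' A v\<^sub>0)"

text \<open>Division by the monic polynomial with roots \<open>\<theta> 1, \<dots>, \<theta> m\<close> splits the last \<open>A\<close>-factor
  into one of degree less than \<open>m\<close> and one for which the last two factors contribute a scalar.\<close>

lemma reversible_low_degree_last:
  assumes ps: "odd (length ps)" "low_degree (Suc m) (last ps)"
    and shorter: "\<And>qs. odd (length qs) \<Longrightarrow> length qs < length ps \<Longrightarrow> reversible qs"
    and lower: "\<And>qs k. length qs = length ps \<Longrightarrow> k < length qs \<Longrightarrow> low_degree m (qs ! k) \<Longrightarrow> reversible qs"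
  shows "reversible ps"
proof (cases "length ps = 1")
  case True
  then show ?thesis by (cases ps) (simp_all add: reversible_def)
next
  case False
  then obtain us s p where us: "ps = us @ [s, p]" "odd (length us)"
    using ps(1) by (cases ps rule: rev_cases; cases "butlast ps" rule: rev_cases) auto
  define r where "r = (\<Prod>i\<in>{1..m}. [:- \<theta> i, 1:])"
  have "r \<noteq> 0" by (simp add: r_def)
  have "degree r \<le> (\<Sum>i\<in>{1..m}. degree [:- \<theta> i, 1:])"
    unfolding r_def using degree_prod_sum_le[of "{1..m}" "\<lambda>i. [:- \<theta> i, 1:]"] by (simp add: o_def)
  then have deg_r: "degree r \<le> m" by simp
  define s\<^sub>1 s\<^sub>2 where "s\<^sub>1 = r * (s div r)" and "s\<^sub>2 = s mod r"
  have s: "s = s\<^sub>1 + s\<^sub>2" by (simp add: s\<^sub>1_def s\<^sub>2_def)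
  \<comment> \<open>A zero remainder is covered too; for \<open>m = 0\<close> the divisor is 1 and
    the remainder is always zero.\<close>
  have "low_degree m s\<^sub>2"
    using degree_mod_less[OF \<open>r \<noteq> 0\<close>, of s] deg_r
    by (auto simp: s\<^sub>2_def low_degree_def intro: coeff_eq_0)
  then have 2: "reversible (us @ [s\<^sub>2, p])"
    by (intro lower[of _ "length us"]) (simp_all add: us nth_append)
  have p: "degree p \<le> m" using ps(2) by (simp add: us low_degree_Suc_iff)
  have root: "poly s\<^sub>1 (\<theta> i) = 0" if "i \<in> {1..m}" for i
    using that by (auto simp: s\<^sub>1_def r_def poly_prod intro!: prod_zero)
  note lin = Endo_add Endo_scale alt_word_Endo poly_op_Endo functional_add functional_scale f(1) E_A
  have slot: "poly_op A s\<^sub>1 (poly_op A' p v\<^sub>0) = (poly s\<^sub>1 (\<theta> 0) * f (poly_op A' p v\<^sub>0)) *s v\<^sub>0"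
    "f (poly_op A' p (poly_op A s\<^sub>1 w)) = poly s\<^sub>1 (\<theta> 0) * f (poly_op A' p v\<^sub>0) * f w" for w
    by (rule poly_op_last_slot[OF p root], assumption)+
  \<comment> \<open>The last two factors give the same scalar in the word and in its reversal, which
    leaves the shorter odd word \<open>us\<close>.\<close>
  have 1: "reversible (us @ [s\<^sub>1, p])"
    using shorter[of us] us(2) slot unfolding reversible_def
    by (simp add: us alt_word_append lin)
  show ?thesis
    using 1 2 us(2) unfolding reversible_def
    by (simp add: us s alt_word_append poly_op_add lin)
qed

text \<open>Three nested inductions: on the length, on a degree bound \<open>m\<close> met by some
  factor, and on the distance of that factor from the right end.\<close>

lemma reversible_if_odd: "odd (length ps) \<Longrightarrow> reversible ps"
proof (induction "length ps" arbitrary: ps rule: less_induct)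
  case less
  let ?n = "length ps"
  have shorter: "reversible qs" if "odd (length qs)" "length qs < ?n" for qs
    using less that by blast
  have low: "reversible qs" if "length qs = ?n" "k < length qs" "low_degree m (qs ! k)" for qs m k
    using that
  proof (induction m arbitrary: qs k)
    case 0
    then have "0 \<in> set qs" by (metis low_degree_0 nth_mem)
    then show ?case by (simp add: reversible_def alt_word_eq_0 E_A)
  next
    case (Suc m)
    have last: "reversible us" if "length us = ?n" "low_degree (Suc m) (last us)" for us
      using that less.prems shorter Suc.IH by (intro reversible_low_degree_last[of us m]) auto
    from Suc.prems show ?case
    proof (induction "?n - Suc k" arbitrary: k qs)
      case 0
      then have "last qs = qs ! k"
        by (subst last_conv_nth) (auto intro: arg_cong[of _ _ "(!) qs"])
      then show ?case using 0 by (intro last) auto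
    next
      case (Suc j)
      show ?case
      proof (cases k)
        \<comment> \<open>A factor at the left end moves to the right end on reversal, and
          reversibility is invariant under reversal.\<close>
        case 0
        then have "last (rev qs) = qs ! 0"
          using Suc.prems(2) by (cases qs) auto
        then have "reversible (rev qs)" using Suc 0 by (intro last) auto
        then show ?thesis by (simp add: reversible_def)
      next
        case (Suc l)
        have "Suc (Suc l) < length qs" using Suc.hyps(2) Suc.prems Suc by simp
        define xs p q r ys where "xs = take l qs" and "p = qs ! l" and "q = qs ! Suc l"
          and "r = qs ! Suc (Suc l)" and "ys = drop (Suc (Suc (Suc l))) qs"
        have qs: "qs = xs @ [p, q, r] @ ys"
          using \<open>Suc (Suc l) < length qs\<close>
          by (simp add: xs_def p_def q_def r_def ys_def Cons_nth_drop_Suc Suc_lessD)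
        have xs: "length xs = l" using \<open>Suc (Suc l) < length qs\<close> by (simp add: xs_def)
        have n: "?n = l + 3 + length ys" using Suc.prems(1) xs by (simp add: qs)
        \<comment> \<open>Equal parity on both sides ensures that the window \<open>p, q, r\<close>
          starts with the same operator in the word and in its reversal.\<close>
        then have par: "even (length ys) \<longleftrightarrow> even l" using less.prems by auto
        have q: "degree q \<le> m" using Suc.prems(3) Suc by (simp add: q_def low_degree_Suc_iff)
        \<comment> \<open>A low \<open>p'\<close> has the smaller bound \<open>m\<close>; a low
          \<open>r'\<close> keeps the bound \<open>Suc m\<close> but is one place further right.
          These are the two cases that \<open>sandwich_reduction\<close> asks for.\<close>
        have red: "reversible (xs @ [p', q, r'] @ ys)" if "low_degree m p' \<or> low_degree (Suc m) r'" for p' r'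
          using that
        proof
          assume "low_degree m p'"
          then show ?thesis
            by (intro \<open>\<And>qs k. length qs = ?n \<Longrightarrow> k < length qs \<Longrightarrow> low_degree m (qs ! k) \<Longrightarrow> reversible qs\<close>[of _ l])
              (auto simp: n xs nth_append)
        next
          assume "low_degree (Suc m) r'"
          then show ?thesis
            using Suc.hyps(2) Suc
            by (intro Suc.hyps(1)[of "Suc k"]) (auto simp: n xs nth_append)
        qed
        define B C where "B = (if even l then A' else A)" and "C = (if even l then A else A')"
        define x y where "x = alt_word ys C B v\<^sub>0" and "y = alt_word (rev xs) C B v\<^sub>0"
        define g h where "g = f \<circ> alt_word xs A' A" and "h = f \<circ> alt_word (rev ys) A' A"
        have gh: "functional g" "functional h"
          by (simp_all add: g_def h_def functional_comp_Endo f alt_word_Endo E_A)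
        have word: "reversible (xs @ [p', q, r'] @ ys) \<longleftrightarrow>
            g (poly_op B p' (poly_op C q (poly_op B r' x))) = h (poly_op B r' (poly_op C q (poly_op B p' y)))" for p' r'
          by (simp add: reversible_def g_def h_def x_def y_def B_def C_def alt_word_append xs par)
        have "\<exists>d \<theta>. tridiagonal_on B C d \<theta>"
          using tri tri' by (auto simp: B_def C_def)
        then obtain d' \<eta> where "tridiagonal_on B C d' \<eta>" by blast
        from sandwich_reduction[OF this gh q] red show ?thesis
          unfolding qs word by blast
      qed
    qed
  qed
  have "ps \<noteq> []" using less.prems by auto
  then show ?case
    using low[of ps 0 "Suc (degree (ps ! 0))"] by (simp add: low_degree_Suc_iff)
qed

subsection \<open>The invariant form and the anti-automorphism\<close>

abbreviation word :: "'a poly list \<Rightarrow> 'b \<Rightarrow> 'b" where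
  "word ps \<equiv> alt_word ps A' A"

lemma word_Endo: "word ps \<in> Endo"
  by (intro alt_word_Endo E_A)

lemmas word_simps = alt_word_append poly_op_1 poly_op_X E_A

definition word_orbit :: "'b set" where
  "word_orbit = {word ps v\<^sub>0 | ps. odd (length ps)}"

lemma word_orbitI: "odd (length ps) \<Longrightarrow> word ps v\<^sub>0 \<in> word_orbit"
  by (auto simp: word_orbit_def)

text \<open>The span is invariant under \<open>A\<close> and \<open>A'\<close> and contains
  \<open>v\<^sub>0\<close>, so irreducibility applies.\<close>

lemma span_word_orbit: "span word_orbit = UNIV"
proof -
  have stable: "Y ` span word_orbit \<subseteq> span word_orbit"
    if "Y \<in> Endo" "\<And>ps. odd (length ps) \<Longrightarrow> Y (word ps v\<^sub>0) \<in> word_orbit" for Y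
  proof
    fix y assume "y \<in> Y ` span word_orbit"
    then obtain x where "x \<in> span word_orbit" "y = Y x" by auto
    from this(1) have "Y x \<in> span word_orbit"
    proof (induction rule: span_induct_alt)
      case base
      then show ?case by (simp add: Endo_0 that(1) span_zero)
    next
      case (step c s t)
      then have "Y s \<in> span word_orbit"
        using that(2) by (intro span_base) (auto simp: word_orbit_def)
      with step show ?case by (simp add: Endo_add Endo_scale that(1) span_add span_scale)
    qed
    with \<open>y = Y x\<close> show "y \<in> span word_orbit" by simp
  qed
  have "A ` span word_orbit \<subseteq> span word_orbit"
  proof (rule stable[OF E_A(1)])
    fix ps :: "'a poly list" assume "odd (length ps)"
    then show "A (word ps v\<^sub>0) \<in> word_orbit"
      \<comment> \<open>The factor 1 fills a slot of \<open>A'\<close>, so the length stays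
        odd.\<close>
      using word_orbitI[of "1 # [:0, 1:] # ps"] by (simp add: word_simps)
  qed
  moreover have "A' ` span word_orbit \<subseteq> span word_orbit"
  proof (rule stable[OF E_A(2)])
    fix ps :: "'a poly list" assume "odd (length ps)"
    then show "A' (word ps v\<^sub>0) \<in> word_orbit"
      using word_orbitI[of "[:0, 1:] # 1 # ps"] by (simp add: word_simps)
  qed
  moreover have "v\<^sub>0 \<in> span word_orbit"
    using word_orbitI[of "[1]"] by (intro span_base) (simp add: word_simps)
  ultimately show ?thesis using irred[of "span word_orbit"] v0(2) by auto
qed

text \<open>Dual to \<open>span_word_orbit\<close>: the common kernel is an invariant subspace that
  misses \<open>v\<^sub>0\<close>.\<close>

lemma words_separate:
  assumes "\<And>ps. odd (length ps) \<Longrightarrow> f (word ps v) = 0"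
  shows "v = 0"
proof -
  define N where "N = {v. \<forall>ps. odd (length ps) \<longrightarrow> f (word ps v) = 0}"
  have "subspace N"
    by (auto simp: subspace_def N_def Endo_0 Endo_add Endo_scale word_Endo f(1)
        functional_0 functional_add functional_scale)
  moreover have "A ` N \<subseteq> N"
  proof clarify
    fix v assume "v \<in> N"
    then have "f (word (ps @ [[:0, 1:], 1]) v) = 0" if "odd (length ps)" for ps
      using that by (simp add: N_def)
    then show "A v \<in> N" by (auto simp: N_def word_simps)
  qed
  moreover have "A' ` N \<subseteq> N"
  proof clarify
    fix v assume "v \<in> N"
    then have "f (word (ps @ [1, [:0, 1:]]) v) = 0" if "odd (length ps)" for ps
      using that by (simp add: N_def)
    then show "A' v \<in> N" by (auto simp: N_def word_simps)
  qed
  moreover have "v\<^sub>0 \<notin> N"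
    by (auto simp: N_def word_simps f_v0 intro!: exI[of _ "[1]"])
  ultimately have "N = {0}" using irred[of N] by auto
  then show ?thesis using assms by (auto simp: N_def)
qed

lemma word_pairing_symmetric:
  assumes "odd (length ps)" "odd (length qs)"
  shows "f (word (rev ps) (word qs v\<^sub>0)) = f (word (rev qs) (word ps v\<^sub>0))"
proof -
  \<comment> \<open>The factor 1 occupies the slot of \<open>A\<close> between two words that both
    have \<open>A'\<close> at their ends.\<close>
  have "reversible (rev ps @ [1] @ qs)"
    using assms by (intro reversible_if_odd) simp
  then show ?thesis
    using assms by (simp add: reversible_def word_simps)
qed

lemma invariant_form_exists:
  obtains \<beta> :: "'b \<Rightarrow> 'b \<Rightarrow> 'a" where
    "nondegenerate_symmetric_form \<beta>"
    "\<And>u v. \<beta> (A u) v = \<beta> u (A v)" "\<And>u v. \<beta> (A' u) v = \<beta> u (A' v)"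
    "\<And>ps v. odd (length ps) \<Longrightarrow> \<beta> (word ps v\<^sub>0) v = f (word (rev ps) v)"
proof -
  \<comment> \<open>Defining the form by coordinates in a basis of word vectors avoids a proof of
    well-definedness; \<open>key\<close> then gives the formula for every odd word.\<close>
  obtain C where C: "C \<subseteq> word_orbit" "independent C" "word_orbit \<subseteq> span C"
    using maximal_independent_subset by metis
  have span_C: "span C = UNIV"
    using span_minimal[OF C(3) subspace_span] span_word_orbit by auto
  have "\<forall>b\<in>C. \<exists>ps. odd (length ps) \<and> b = word ps v\<^sub>0"
    using C(1) by (auto simp: word_orbit_def)
  then obtain w where w: "\<And>b. b \<in> C \<Longrightarrow> odd (length (w b))" "\<And>b. b \<in> C \<Longrightarrow> word (w b) v\<^sub>0 = b"
    by metis
  define \<beta> where "\<beta> u v = (\<Sum>b\<in>C. representation C u b * f (word (rev (w b)) v))" for u v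
  note lin = f(1)[THEN functional_add] f(1)[THEN functional_scale] f(1)[THEN functional_sum] Endo_add Endo_scale Endo_sum word_Endo
  have right: "functional (\<beta> u)" for u
    unfolding functional_def
    by (simp add: \<beta>_def lin distrib_left sum.distrib sum_distrib_left mult.left_commute)
  have left: "functional (\<lambda>u. \<beta> u v)" for v
    unfolding functional_def
    by (simp add: \<beta>_def representation_add representation_scale C span_C distrib_right
        sum.distrib sum_distrib_left mult.assoc)
  have key: "\<beta> (word ps v\<^sub>0) v = f (word (rev ps) v)" if ps: "odd (length ps)" for ps v
  proof (rule functional_eq_on_span[OF right, where S = word_orbit])
    show "functional (\<lambda>v. f (word (rev ps) v))" unfolding functional_def by (simp add: lin)
    fix v assume "v \<in> word_orbit"
    then obtain qs where qs: "odd (length qs)" "v = word qs v\<^sub>0" by (auto simp: word_orbit_def)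
    have "\<beta> (word ps v\<^sub>0) v = (\<Sum>b\<in>C. representation C (word ps v\<^sub>0) b * f (word (rev qs) b))"
      unfolding \<beta>_def qs(2)
      using word_pairing_symmetric[OF w(1) qs(1)] w(2) by (intro sum.cong) auto
    also have "\<dots> = f (word (rev qs) (\<Sum>b\<in>C. representation C (word ps v\<^sub>0) b *s b))"
      by (simp add: lin)
    also have "(\<Sum>b\<in>C. representation C (word ps v\<^sub>0) b *s b) = word ps v\<^sub>0"
      by (rule sum_representation_eq) (simp_all add: C span_C finiteI_independent)
    also have "f (word (rev qs) (word ps v\<^sub>0)) = f (word (rev ps) v)"
      using word_pairing_symmetric[OF ps qs(1)] qs(2) by simp
    finally show "\<beta> (word ps v\<^sub>0) v = f (word (rev ps) v)" .
  qed (simp add: span_word_orbit)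
  have orbit_eqI: "g v = h v"
    if "functional g" "functional h" "\<And>ps. odd (length ps) \<Longrightarrow> g (word ps v\<^sub>0) = h (word ps v\<^sub>0)" for g h v
  proof (rule functional_eq_on_span[OF that(1,2)])
    show "v \<in> span word_orbit" by (simp add: span_word_orbit)
  qed (use that(3) in \<open>auto simp: word_orbit_def\<close>)
  have sym: "\<beta> u v = \<beta> v u" for u v
  proof (rule orbit_eqI[OF left right])
    fix ps :: "'a poly list" assume ps: "odd (length ps)"
    show "\<beta> (word ps v\<^sub>0) v = \<beta> v (word ps v\<^sub>0)"
      by (rule orbit_eqI[OF right left]) (use word_pairing_symmetric ps in \<open>auto simp: key\<close>)
  qed
  have adj: "\<beta> (Y u) v = \<beta> u (Y v)"
    if "Y \<in> Endo" "\<And>ps. odd (length ps) \<Longrightarrow> \<beta> (Y (word ps v\<^sub>0)) v = f (word (rev ps) (Y v))" for Y u v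
    by (rule orbit_eqI[where g = "\<lambda>u. \<beta> (Y u) v"])
      (use functional_comp_Endo[OF left that(1), of v] that(2) left in \<open>auto simp: key o_def\<close>)
  show ?thesis
  proof (rule that[OF _ _ _ key])
    have "v = 0" if "\<forall>u. \<beta> u v = 0" for v
    proof (rule words_separate)
      fix ps :: "'a poly list" assume "odd (length ps)"
      then show "f (word ps v) = 0" using key[of "rev ps" v] that by simp
    qed
    then show "nondegenerate_symmetric_form \<beta>"
      unfolding nondegenerate_symmetric_form_def using right sym by blast
  next
    show "\<beta> (A u) v = \<beta> u (A v)" for u v
    proof (rule adj[OF E_A(1)])
      fix ps :: "'a poly list" assume "odd (length ps)"
      then show "\<beta> (A (word ps v\<^sub>0)) v = f (word (rev ps) (A v))"
        using key[of "1 # [:0, 1:] # ps" v] by (simp add: word_simps)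
    qed
    show "\<beta> (A' u) v = \<beta> u (A' v)" for u v
    proof (rule adj[OF E_A(2)])
      fix ps :: "'a poly list" assume "odd (length ps)"
      then show "\<beta> (A' (word ps v\<^sub>0)) v = f (word (rev ps) (A' v))"
        using key[of "[:0, 1:] # 1 # ps" v] by (simp add: word_simps)
    qed
  qed
qed

text \<open>The projection onto the line spanned by \<open>v\<^sub>0\<close> lies in the generated algebra, and with the
  invariant form all rank one maps are obtained from it.\<close>

lemma Endo_generated:
  assumes id: "id \<in> Z"
    and add: "\<And>X Y. X \<in> Z \<Longrightarrow> Y \<in> Z \<Longrightarrow> (\<lambda>v. X v + Y v) \<in> Z"
    and scale: "\<And>c X. X \<in> Z \<Longrightarrow> (\<lambda>v. c *s X v) \<in> Z"
    and comp: "\<And>X Y. X \<in> Z \<Longrightarrow> Y \<in> Z \<Longrightarrow> X \<circ> Y \<in> Z"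
    and Z: "A \<in> Z" "A' \<in> Z" and X: "X \<in> Endo"
  shows "X \<in> Z"
proof -
  obtain \<beta> :: "'b \<Rightarrow> 'b \<Rightarrow> 'a" where
    form: "nondegenerate_symmetric_form \<beta>"
    and key: "\<And>ps v. odd (length ps) \<Longrightarrow> \<beta> (word ps v\<^sub>0) v = f (word (rev ps) v)"
    by (rule invariant_form_exists) blast
  have zero: "(\<lambda>v. 0) \<in> Z" using scale[OF id, of 0] by simp
  have sum: "(\<lambda>v. \<Sum>b\<in>I. Y b v) \<in> Z" if "\<And>b. b \<in> I \<Longrightarrow> Y b \<in> Z" for I and Y :: "'b \<Rightarrow> 'b \<Rightarrow> 'b"
    using that by (induction I rule: infinite_finite_induct) (simp_all add: zero add)
  have poly: "poly_op B p \<in> Z" if "B \<in> Z" "B \<in> Endo" for B p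
  proof (induction p)
    case (pCons a p)
    have "poly_op B (pCons a p) = (\<lambda>v. a *s id v + (B \<circ> poly_op B p) v)"
      by (rule ext) (simp add: poly_op_pCons that)
    then show ?case using add[OF scale[OF id, of a] comp[OF that(1) pCons(2)]] by simp
  qed (simp add: zero)
  have words: "alt_word ps B C \<in> Z" if "B \<in> {A, A'}" "C \<in> {A, A'}" for ps B C
    using that
  proof (induction ps arbitrary: B C)
    case (Cons p ps)
    have "poly_op B p \<in> Z" using Cons.prems(1) Z E_A by (intro poly) auto
    then show ?case unfolding alt_word.simps by (rule comp[OF _ Cons.IH[OF Cons.prems(2,1)]])
  qed (simp add: id)
  \<comment> \<open>By linearity in \<open>w\<close> and \<open>u\<close> both may be word vectors.
    The map is then a word, followed by the projection onto the line of \<open>v\<^sub>0\<close>,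
    followed by another word.\<close>
  have rank1: "(\<lambda>v. \<beta> w v *s u) \<in> Z" for u w
  proof -
    have "w \<in> span word_orbit" "u \<in> span word_orbit" by (simp_all add: span_word_orbit)
    then show ?thesis
    proof (induction w arbitrary: u rule: span_induct_alt)
      case base
      then show ?case by (simp add: form_sym[OF form, of 0] functional_0[OF form_right[OF form]] zero)
    next
      case (step c x y)
      from step.prems have "(\<lambda>v. \<beta> x v *s u) \<in> Z"
      proof (induction u rule: span_induct_alt)
        case base
        then show ?case by (simp add: zero)
      next
        case (step a s t)
        obtain ps qs where ps: "odd (length ps)" "x = word ps v\<^sub>0" and qs: "s = word qs v\<^sub>0"
          using \<open>x \<in> word_orbit\<close> \<open>s \<in> word_orbit\<close> by (auto simp: word_orbit_def)
        have "(\<lambda>v. \<beta> x v *s s) = word qs \<circ> eigenproj A d \<theta> 0 \<circ> word (rev ps)"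
          by (rule ext) (simp add: ps qs key f(2) Endo_scale word_Endo)
        also have "\<dots> \<in> Z"
          unfolding eigenproj_def by (intro comp words poly Z E_A) auto
        finally have "(\<lambda>v. \<beta> x v *s s) \<in> Z" .
        from add[OF scale[OF this, of a] step.IH] show ?case
          by (simp add: scale_right_distrib mult.commute)
      qed
      from add[OF scale[OF this, of c] step.IH[OF step.prems]] show ?case
        by (simp add: form_sym[OF form, of "c *s x + y"] form_sym[OF form, of x] form_sym[OF form, of y] functional_add[OF form_right[OF form]]
            functional_scale[OF form_right[OF form]] scale_left_distrib)
    qed
  qed
  have "\<exists>w. \<forall>v. \<beta> w v = representation Basis v b" for b
    by (rule functional_represented[OF form functional_representation[OF independent_Basis span_Basis, of b]])
      blast
  then obtain w where w: "\<And>b v. \<beta> (w b) v = representation Basis v b" by metis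
  \<comment> \<open>Representing the coordinate functionals by \<open>\<beta>\<close> writes
    \<open>X\<close> as a sum of rank one maps.\<close>
  have "X = (\<lambda>v. \<Sum>b\<in>Basis. \<beta> (w b) v *s X b)"
  proof
    fix v
    have "X v = X (\<Sum>b\<in>Basis. representation Basis v b *s b)"
      by (simp add: sum_Basis_representation)
    then show "X v = (\<Sum>b\<in>Basis. \<beta> (w b) v *s X b)"
      by (simp add: w X Endo_sum Endo_scale)
  qed
  also have "\<dots> \<in> Z" by (intro sum rank1)
  finally show ?thesis .
qed

section \<open>Uniqueness and existence of the anti-automorphism\<close>

lemma anti_automorphism_unique:
  assumes \<sigma>: "anti_automorphism \<sigma>" "\<sigma> A = A" "\<sigma> A' = A'"
    and \<tau>: "anti_automorphism \<tau>" "\<tau> A = A" "\<tau> A' = A'"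
  shows "\<sigma> = \<tau>"
proof (rule extensionalityI[of _ Endo])
  show "\<sigma> \<in> extensional Endo" "\<tau> \<in> extensional Endo"
    using \<sigma>(1) \<tau>(1) by (simp_all add: anti_automorphism_def)
next
  fix X assume "X \<in> Endo"
  \<comment> \<open>The agreement set is closed under linear combinations and products, because both
    maps reverse products in the same way.\<close>
  have "X \<in> {X \<in> Endo. \<sigma> X = \<tau> X}"
  proof (rule Endo_generated[OF _ _ _ _ _ _ \<open>X \<in> Endo\<close>])
    show "id \<in> {X \<in> Endo. \<sigma> X = \<tau> X}"
      by (simp add: Endo_id anti_automorphism_id \<sigma> \<tau>)
    show "A \<in> {X \<in> Endo. \<sigma> X = \<tau> X}" "A' \<in> {X \<in> Endo. \<sigma> X = \<tau> X}"
      by (simp_all add: E_A \<sigma> \<tau>)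
  next
    fix X Y assume *: "X \<in> {X \<in> Endo. \<sigma> X = \<tau> X}" "Y \<in> {X \<in> Endo. \<sigma> X = \<tau> X}"
    then have "(\<lambda>v. X v + Y v) \<in> Endo"
      by (intro EndoI) (simp_all add: Endo_add Endo_scale algebra_simps)
    with * \<sigma>(1) \<tau>(1) show "(\<lambda>v. X v + Y v) \<in> {X \<in> Endo. \<sigma> X = \<tau> X}"
      by (simp add: anti_automorphism_def)
    from * \<sigma>(1) \<tau>(1) show "X \<circ> Y \<in> {X \<in> Endo. \<sigma> X = \<tau> X}"
      by (simp add: anti_automorphism_def Endo_comp)
  next
    fix c X assume *: "X \<in> {X \<in> Endo. \<sigma> X = \<tau> X}"
    then have "(\<lambda>v. c *s X v) \<in> Endo"
      by (intro EndoI) (simp_all add: Endo_add Endo_scale algebra_simps)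
    with * \<sigma>(1) \<tau>(1) show "(\<lambda>v. c *s X v) \<in> {X \<in> Endo. \<sigma> X = \<tau> X}"
      by (simp add: anti_automorphism_def)
  qed
  then show "\<sigma> X = \<tau> X" by simp
qed

lemma involutive_anti_automorphism_exists:
  obtains \<sigma> where "anti_automorphism \<sigma>" "\<sigma> A = A" "\<sigma> A' = A'" "\<And>X. X \<in> Endo \<Longrightarrow> \<sigma> (\<sigma> X) = X"
proof -
  obtain \<beta> :: "'b \<Rightarrow> 'b \<Rightarrow> 'a" where
    \<beta>: "nondegenerate_symmetric_form \<beta>"
    and inv: "\<And>u v. \<beta> (A u) v = \<beta> u (A v)" "\<And>u v. \<beta> (A' u) v = \<beta> u (A' v)"
    by (rule invariant_form_exists) blast
  show ?thesis
  proof (rule that[of "restrict (adjoint \<beta>) Endo"])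
    show "anti_automorphism (restrict (adjoint \<beta>) Endo)" by (rule adjoint_anti_automorphism[OF \<beta>])
    show "restrict (adjoint \<beta>) Endo A = A" "restrict (adjoint \<beta>) Endo A' = A'"
      using E_A inv by (simp_all add: adjoint_eqI[OF \<beta>])
    show "restrict (adjoint \<beta>) Endo (restrict (adjoint \<beta>) Endo X) = X" if "X \<in> Endo" for X
      using that by (simp add: adjoint_Endo[OF \<beta>] adjoint_adjoint[OF \<beta>])
  qed
qed

end

section \<open>From a sharp tridiagonal pair to eigenvalues and a rank one projection\<close>

lemma standard_ordering_imp_tridiagonal_on:
  assumes "A \<in> Endo" "B \<in> Endo" "diagonalizable A" "standard_ordering A B d V"
  obtains \<theta> where "tridiagonal_on A B d \<theta>" "\<And>i. i \<le> d \<Longrightarrow> V i = eigenspace A (\<theta> i)"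
proof -
  have bij: "bij_betw V {..d} (eigenspaces A)"
    and adj: "\<And>i. i \<le> d \<Longrightarrow> B ` V i \<subseteq> adjacent_sum d V i"
    using assms(4) by (auto simp: standard_ordering_def atMost_atLeast0)
  have "\<exists>t. V i = eigenspace A t" if "i \<le> d" for i
    using bij_betwE[OF bij] that by (auto simp: eigenspaces_def eigenspace_def)
  then obtain \<theta> where \<theta>: "\<And>i. i \<le> d \<Longrightarrow> V i = eigenspace A (\<theta> i)" by metis
  have "inj_on \<theta> {..d}"
    using bij \<theta> by (auto simp: bij_betw_def inj_on_def)
  moreover have "(\<Union>i\<le>d. eigenspace A (\<theta> i)) = \<Union>(eigenspaces A)"
    using bij \<theta> by (auto simp: bij_betw_def)
  then have "span (\<Union>i\<le>d. eigenspace A (\<theta> i)) = UNIV"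
    using assms(3) by (simp add: diagonalizable_def)
  moreover have "B v \<in> span (\<Union>j\<in>{j. j \<le> d \<and> j \<le> Suc i \<and> i \<le> Suc j}. eigenspace A (\<theta> j))"
    if i: "i \<le> d" and v: "v \<in> eigenspace A (\<theta> i)" for i v
  proof -
    let ?S = "span (\<Union>j\<in>{j. j \<le> d \<and> j \<le> Suc i \<and> i \<le> Suc j}. eigenspace A (\<theta> j))"
    have in_span: "w \<in> ?S" if "j \<le> d" "j \<le> Suc i" "i \<le> Suc j" "w \<in> V j" for j w
      using that \<theta> by (intro span_base) auto
    obtain x y z where "B v = x + y + z" "x \<in> (if i = 0 then {0} else V (i - 1))" "y \<in> V i"
      "z \<in> (if i = d then {0} else V (i + 1))"
      using adj[OF i] v \<theta>[OF i] by (auto simp: adjacent_sum_def)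
    moreover from this have "x \<in> ?S" "y \<in> ?S" "z \<in> ?S"
      using i in_span[of "i - 1" x] in_span[of i y] in_span[of "i + 1" z]
      by (auto simp: span_zero split: if_splits)
    ultimately show ?thesis by (simp add: span_add)
  qed
  ultimately have "tridiagonal_on A B d \<theta>"
    using assms by (auto simp: tridiagonal_on_def)
  with \<theta> that show ?thesis by blast
qed

lemma eigenproj_line:
  assumes tri: "tridiagonal_on A B d \<theta>" and dim: "dim (eigenspace A (\<theta> 0)) = 1"
  obtains f v\<^sub>0 where "A v\<^sub>0 = \<theta> 0 *s v\<^sub>0" "v\<^sub>0 \<noteq> 0" "functional f"
    "\<And>v. eigenproj A d \<theta> 0 v = f v *s v\<^sub>0"
proof -
  obtain C where C: "C \<subseteq> eigenspace A (\<theta> 0)" "independent C" "eigenspace A (\<theta> 0) \<subseteq> span C" "card C = 1"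
    using basis_exists dim by metis
  then obtain v\<^sub>0 where C_eq: "C = {v\<^sub>0}" by (auto simp: card_1_singleton_iff)
  have v0: "A v\<^sub>0 = \<theta> 0 *s v\<^sub>0" "v\<^sub>0 \<noteq> 0"
    using C by (auto simp: C_eq eigenspace_def)
  have "\<exists>c. eigenproj A d \<theta> 0 v = c *s v\<^sub>0" for v
  proof -
    have "eigenproj A d \<theta> 0 v \<in> eigenspace A (\<theta> 0)"
      using eigenproj_in_eigenspace[OF tri, of 0] by (simp add: eigenspace_def)
    then show ?thesis using C(3) by (auto simp: C_eq span_singleton)
  qed
  then obtain f where f: "\<And>v. eigenproj A d \<theta> 0 v = f v *s v\<^sub>0" by metis
  note E = eigenproj_Endo[OF tri, of 0]
  \<comment> \<open>Linearity of the projection passes to \<open>f\<close>, since coefficients of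
    the nonzero vector \<open>v\<^sub>0\<close> are unique.\<close>
  have "f (u + v) *s v\<^sub>0 = (f u + f v) *s v\<^sub>0" for u v
    using Endo_add[OF E, of u v] by (simp add: f scale_left_distrib)
  moreover have "f (c *s v) *s v\<^sub>0 = (c * f v) *s v\<^sub>0" for c v
    using Endo_scale[OF E, of c v] by (simp add: f)
  ultimately have "functional f" using v0(2) unfolding functional_def by (metis scale_right_imp_eq)
  with v0 f that show ?thesis by blast
qed

lemma sharp_tridiagonal_pair_anti_automorphism:
  assumes "sharp_tridiagonal_pair A A'"
  shows "(\<exists>!\<sigma>. anti_automorphism \<sigma> \<and> \<sigma> A = A \<and> \<sigma> A' = A') \<and>
    (\<forall>\<sigma>. anti_automorphism \<sigma> \<and> \<sigma> A = A \<and> \<sigma> A' = A' \<longrightarrow> (\<forall>X\<in>Endo. \<sigma> (\<sigma> X) = X))"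
proof -
  obtain d V \<delta> V' where Endo: "A \<in> Endo" "A' \<in> Endo"
    and diag: "diagonalizable A" "diagonalizable A'"
    and V: "standard_ordering A A' d V" "dim (V 0) = 1" and V': "standard_ordering A' A \<delta> V'"
    and irred: "\<And>W. subspace W \<Longrightarrow> A ` W \<subseteq> W \<Longrightarrow> A' ` W \<subseteq> W \<Longrightarrow> W = {0} \<or> W = UNIV"
    using assms by (auto simp: sharp_tridiagonal_pair_def tridiagonal_pair_def)
  obtain \<theta> where tri: "tridiagonal_on A A' d \<theta>" and \<theta>: "\<And>i. i \<le> d \<Longrightarrow> V i = eigenspace A (\<theta> i)"
    using standard_ordering_imp_tridiagonal_on[OF Endo diag(1) V(1)] by blast
  obtain \<theta>' where tri': "tridiagonal_on A' A \<delta> \<theta>'"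
    using standard_ordering_imp_tridiagonal_on[OF Endo(2,1) diag(2) V'] by blast
  obtain f v\<^sub>0 where line: "A v\<^sub>0 = \<theta> 0 *s v\<^sub>0" "v\<^sub>0 \<noteq> 0" "functional f"
    "\<And>v. eigenproj A d \<theta> 0 v = f v *s v\<^sub>0"
    using eigenproj_line[OF tri] V(2) unfolding \<theta>[OF le0] by metis
  note setting = tri tri' line irred
  obtain \<sigma> where \<sigma>: "anti_automorphism \<sigma>" "\<sigma> A = A" "\<sigma> A' = A'" "\<And>X. X \<in> Endo \<Longrightarrow> \<sigma> (\<sigma> X) = X"
    using involutive_anti_automorphism_exists[OF setting] by blast
  \<comment> \<open>Every admissible map equals the adjoint constructed above and so inherits its
    involutivity.\<close>
  have "\<tau> = \<sigma>" if "anti_automorphism \<tau>" "\<tau> A = A" "\<tau> A' = A'" for \<tau>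
    using anti_automorphism_unique[OF setting that \<sigma>(1-3)] .
  with \<sigma> show ?thesis by blast
qed

end

theorem theorem1p5:
  fixes scale :: "'a::field \<Rightarrow> 'b::ab_group_add \<Rightarrow> 'b"
    and Basis :: "'b set"
    and A A' :: "'b \<Rightarrow> 'b"
  assumes "finite_dimensional_vector_space scale Basis"
    and "vector_space.dim scale (UNIV :: 'b set) > 0"
    and "vector_space.sharp_tridiagonal_pair scale A A'"
  shows "(\<exists>!\<sigma>. vector_space.anti_automorphism scale \<sigma> \<and> \<sigma> A = A \<and> \<sigma> A' = A') \<and>
         (\<forall>\<sigma>. vector_space.anti_automorphism scale \<sigma> \<and> \<sigma> A = A \<and> \<sigma> A' = A' \<longrightarrow>
              (\<forall>X\<in>vector_space.Endo scale. \<sigma> (\<sigma> X) = X))"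
proof -
  interpret finite_dimensional_operators scale Basis
    using assms(1) by (simp add: finite_dimensional_operators_def)
  show ?thesis
    using assms(3) by (rule sharp_tridiagonal_pair_anti_automorphism)
qed

end
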